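(* (Closure condition) Let $H_n$ denote $\mathbb{R}^n$ or $\mathbb{C}^n$, and let $P\subseteq 2^I$ be the factor poset of a frame $\{f_i\}_{i\in I}\subseteq H_n$ of nonzero vectors, $I$ finite. If $J$ and $K$ are copies of each other (with respect to $P$), and there exists $A\in P$ such that $J\subseteq A$ and $K\cap A=\emptyset$, then $(A\setminus J)\cup K\in P$.
   Context: A frame for $H_n$ is a finite sequence $\{f_i\}_{i\in I}$ (repetitions allowed) spanning $H_n$. It is tight if there is $\lambda>0$ with $\sum_{i\in I}|\langle x,f_i\rangle|^2=\lambda\|x\|^2$ for all $x\in H_n$. The factor poset of a frame $F=\{f_i\}_{i\in I}$ is $\mathbb{F}_F=\{J\subseteq I:\{f_j\}_{j\in J}\text{ is a tight frame for }H_n\}$, ordered by inclusion, with the convention $\emptyset\in\mathbb{F}_F$. For a poset $P\subseteq 2^I$, two sets $J,K\subseteq I$ are copies of each other (with respect to $P$) if there are $B,C\in P$ such that $J=B\setminus C$ and $K=C\setminus B$. *)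

theory Defs
  imports "HOL-Analysis.Analysis"
begin

(* The library's inner product on complex^'n is the real-valued one of the underlying
   real space, so the Hermitian inner product has to be defined here. *)
definition cinner :: "complex ^ 'n \<Rightarrow> complex ^ 'n \<Rightarrow> complex" where
  "cinner x y = (\<Sum>k\<in>UNIV. x $ k * cnj (y $ k))"

(* vec.span is the span over the scalar field 'k itself, whereas the plain span constant
   would mean the real span even when 'k is complex. *)
definition is_frame :: "('i \<Rightarrow> 'k::field ^ 'n) \<Rightarrow> 'i set \<Rightarrow> bool" where
  "is_frame f I \<longleftrightarrow> finite I \<and> vec.span (f ` I) = UNIV"

(* The parameter ip is the inner product of the space: inner over the reals,
   cinner over the complex numbers. *)
definition tight_frame ::
  "('k ^ 'n \<Rightarrow> 'k ^ 'n \<Rightarrow> 'k::real_normed_field) \<Rightarrow> ('i \<Rightarrow> 'k ^ 'n) \<Rightarrow> 'i set \<Rightarrow> bool" where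
  "tight_frame ip f I \<longleftrightarrow> is_frame f I \<and>
     (\<exists>l::real. l > 0 \<and> (\<forall>x. (\<Sum>i\<in>I. (norm (ip x (f i)))\<^sup>2) = l * (norm x)\<^sup>2))"

definition factor_poset ::
  "('k ^ 'n \<Rightarrow> 'k ^ 'n \<Rightarrow> 'k::real_normed_field) \<Rightarrow> ('i \<Rightarrow> 'k ^ 'n) \<Rightarrow> 'i set \<Rightarrow> 'i set set" where
  "factor_poset ip f I = {J. J \<subseteq> I \<and> (J = {} \<or> tight_frame ip f J)}"

definition copies :: "'i set \<Rightarrow> 'i set set \<Rightarrow> 'i set \<Rightarrow> 'i set \<Rightarrow> bool" where
  "copies I P J K \<longleftrightarrow> J \<subseteq> I \<and> K \<subseteq> I \<and> (\<exists>B\<in>P. \<exists>C\<in>P. J = B - C \<and> K = C - B)"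

end

theory Submission
  imports Defs
begin

text \<open>For a set of indices J of nonzero vectors, J lies in the factor poset as soon as
  the frame sum over J is any real multiple of the squared norm: the multiple is
  nonnegative, it vanishes only for empty J (test with \<open>x = f i\<close>), and a positive
  one forces the vectors to span, since no nonzero x is orthogonal to all of them.
  So membership is linear in the frame sum, and
  \<open>S(A - J \<union> K) = S(A) - S(B) + S(C)\<close>.\<close>

text \<open>Over the reals \<open>vec.span\<close> is the ordinary \<open>span\<close>, so the
  library's orthogonal vector to a proper subspace serves directly.\<close>

lemma real_orthogonal_to_span:
  fixes S :: "(real ^ 'n) set"
  assumes "vec.span S \<noteq> UNIV"
  shows "\<exists>x. x \<noteq> 0 \<and> (\<forall>y\<in>S. inner x y = 0)"
proof -
  have "span S \<noteq> UNIV"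
    using assms by (simp add: span_vec_eq)
  then show ?thesis
    using span_not_UNIV_orthogonal[of S] by (meson span_base)
qed

text \<open>The bridge through which facts about real orthogonality reach the Hermitian
  product.\<close>

lemma Re_cinner: "Re (cinner x y) = inner x y"
  by (simp add: cinner_def inner_vec_def inner_complex_def)

lemma cinner_scale_right: "cinner x (c *s y) = cnj c * cinner x y"
  by (simp add: cinner_def sum_distrib_left algebra_simps)

lemma cinner_self_eq_0: "cinner x x = 0 \<longleftrightarrow> x = 0"
proof
  assume "cinner x x = 0"
  then have "inner x x = 0"
    using Re_cinner[of x x] by simp
  then show "x = 0" by simp
qed (simp add: cinner_def)

text \<open>A complex subspace is also a real one, so a proper one has a nonzero real-orthogonal
  vector \<open>x\<close>. Closure under multiplication by \<open>\<i>\<close> upgrades this to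
  Hermitian orthogonality.\<close>

lemma complex_orthogonal_to_span:
  fixes S :: "(complex ^ 'n) set"
  assumes "vec.span S \<noteq> UNIV"
  shows "\<exists>x. x \<noteq> 0 \<and> (\<forall>y\<in>S. cinner x y = 0)"
proof -
  have scaleR: "r *\<^sub>R x = complex_of_real r *s x" for r and x :: "complex ^ 'n"
    by (simp add: vec_eq_iff scaleR_conv_of_real[where x = "x $ i" for i])
  have "subspace (vec.span S)"
    by (auto simp: subspace_def scaleR vec.span_zero vec.span_add vec.span_scale)
  then have eq: "span (vec.span S) = vec.span S"
    by (rule span_eq_iff[THEN iffD2])
  obtain x where x: "x \<noteq> 0" and orth: "\<And>y. y \<in> vec.span S \<Longrightarrow> inner x y = 0"
    using span_not_UNIV_orthogonal[of "vec.span S"] assms unfolding eq by blast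
  have "cinner x y = 0" if "y \<in> S" for y
  proof (rule complex_eqI)
    show "Re (cinner x y) = Re 0"
      using orth[OF vec.span_base[OF that]] by (simp add: Re_cinner)
    \<comment> \<open>Conjugate linearity turns the factor \<open>\<i>\<close> into
      \<open>-\<i>\<close>, so this real part is the imaginary part of
      \<open>cinner x y\<close>.\<close>
    have "Re (cinner x (\<i> *s y)) = 0"
      using orth[OF vec.span_scale[OF vec.span_base[OF that]]] by (simp add: Re_cinner)
    then show "Im (cinner x y) = Im 0"
      by (simp add: cinner_scale_right)
  qed
  with x show ?thesis by blast
qed

text \<open>Trades positivity, spanning and the exception for the empty set for a condition that
  survives linear combinations. The product \<open>ip\<close> enters only through
  \<open>definite\<close> and \<open>orth\<close>, so one argument covers both fields.\<close>

lemma factor_poset_iff: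
  fixes ip :: "'k ^ 'n \<Rightarrow> 'k ^ 'n \<Rightarrow> 'k::real_normed_field"
  assumes "finite I" and nz: "\<And>i. i \<in> I \<Longrightarrow> f i \<noteq> 0"
    and definite: "\<And>x. ip x x = 0 \<Longrightarrow> x = 0"
    and orth: "\<And>S. vec.span S \<noteq> UNIV \<Longrightarrow> \<exists>x. x \<noteq> 0 \<and> (\<forall>y\<in>S. ip x y = 0)"
  shows "J \<in> factor_poset ip f I \<longleftrightarrow>
    J \<subseteq> I \<and> (\<exists>l. \<forall>x. (\<Sum>i\<in>J. (norm (ip x (f i)))\<^sup>2) = l * (norm x)\<^sup>2)"
    (is "_ \<longleftrightarrow> _ \<and> (\<exists>l. ?tight l)")
proof
  assume "J \<in> factor_poset ip f I"
  then show "J \<subseteq> I \<and> (\<exists>l. ?tight l)"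
    \<comment> \<open>The witness 0 is for empty \<open>J\<close>, whose frame sum vanishes.\<close>
    by (auto simp: factor_poset_def tight_frame_def intro: exI[of _ 0])
next
  assume "J \<subseteq> I \<and> (\<exists>l. ?tight l)"
  then obtain l where J: "J \<subseteq> I" and l: "?tight l" by blast
  have fin: "finite J"
    using J assms(1) by (rule finite_subset)
  have "tight_frame ip f J" if "J \<noteq> {}"
  proof -
    obtain i where i: "i \<in> J" using \<open>J \<noteq> {}\<close> by blast
    then have fi: "f i \<noteq> 0" using nz J by blast
    have "0 < (norm (ip (f i) (f i)))\<^sup>2"
      using definite fi by auto
    also have "\<dots> \<le> (\<Sum>j\<in>J. (norm (ip (f i) (f j)))\<^sup>2)"
      using fin i by (intro member_le_sum) auto
    also have "\<dots> = l * (norm (f i))\<^sup>2"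
      using l by blast
    finally have "l > 0"
      by (simp add: zero_less_mult_iff)
    have "vec.span (f ` J) = UNIV"
    proof (rule ccontr)
      assume "vec.span (f ` J) \<noteq> UNIV"
      then obtain x where x: "x \<noteq> 0" and "\<forall>y\<in>f ` J. ip x y = 0"
        using orth by blast
      then have "(\<Sum>j\<in>J. (norm (ip x (f j)))\<^sup>2) = 0" by simp
      then show False
        using l x \<open>l > 0\<close> by simp
    qed
    then show ?thesis
      using fin l \<open>l > 0\<close> by (auto simp: tight_frame_def is_frame_def)
  qed
  then show "J \<in> factor_poset ip f I"
    using J by (auto simp: factor_poset_def)
qed

text \<open>Removing \<open>B - C\<close> and adding \<open>C - B\<close> changes the sum by
  \<open>sum g C - sum g B\<close>, because the contribution of \<open>B \<inter> C\<close>
  cancels.\<close>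

lemma sum_exchange_copies:
  fixes g :: "'i \<Rightarrow> 'b::ab_group_add"
  assumes "finite A" "finite B" "finite C" "B - C \<subseteq> A" "(C - B) \<inter> A = {}"
  shows "sum g ((A - (B - C)) \<union> (C - B)) = sum g A - sum g B + sum g C"
proof -
  have "sum g ((A - (B - C)) \<union> (C - B)) = sum g (A - (B - C)) + sum g (C - B)"
    using assms by (intro sum.union_disjoint) auto
  moreover have "sum g (A - (B - C)) = sum g A - sum g (B - C)"
    using assms by (intro sum_diff) auto
  moreover have "sum g B = sum g (B \<inter> C) + sum g (B - C)"
    using assms by (intro sum.Int_Diff) auto
  moreover have "sum g C = sum g (C \<inter> B) + sum g (C - B)"
    using assms by (intro sum.Int_Diff) auto
  ultimately show ?thesis
    by (simp add: Int_commute)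
qed

lemma factor_poset_closure:
  fixes ip :: "'k ^ 'n \<Rightarrow> 'k ^ 'n \<Rightarrow> 'k::real_normed_field"
  assumes "finite I" and nz: "\<And>i. i \<in> I \<Longrightarrow> f i \<noteq> 0"
    and definite: "\<And>x. ip x x = 0 \<Longrightarrow> x = 0"
    and orth: "\<And>S. vec.span S \<noteq> UNIV \<Longrightarrow> \<exists>x. x \<noteq> 0 \<and> (\<forall>y\<in>S. ip x y = 0)"
    and copies: "copies I (factor_poset ip f I) J K"
    and A: "A \<in> factor_poset ip f I" "J \<subseteq> A" "K \<inter> A = {}"
  shows "(A - J) \<union> K \<in> factor_poset ip f I"
proof -
  have iff: "X \<in> factor_poset ip f I \<longleftrightarrow>
    X \<subseteq> I \<and> (\<exists>l. \<forall>x. (\<Sum>i\<in>X. (norm (ip x (f i)))\<^sup>2) = l * (norm x)\<^sup>2)" for X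
    by (rule factor_poset_iff) fact+
  define S where "S X x = (\<Sum>i\<in>X. (norm (ip x (f i)))\<^sup>2)" for X x
  obtain B C where BC: "B \<in> factor_poset ip f I" "C \<in> factor_poset ip f I"
    and JK: "J = B - C" "K = C - B" and "K \<subseteq> I"
    using copies by (auto simp: copies_def)
  obtain a where a: "\<And>x. S A x = a * (norm x)\<^sup>2"
    using A(1) unfolding iff S_def by blast
  obtain b where b: "\<And>x. S B x = b * (norm x)\<^sup>2"
    using BC(1) unfolding iff S_def by blast
  obtain c where c: "\<And>x. S C x = c * (norm x)\<^sup>2"
    using BC(2) unfolding iff S_def by blast
  have sub: "A \<subseteq> I" "B \<subseteq> I" "C \<subseteq> I"
    using A(1) BC unfolding iff by auto
  then have "finite A" "finite B" "finite C"
    using assms(1) by (auto intro: finite_subset)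
  then have "S ((A - J) \<union> K) x = S A x - S B x + S C x" for x
    unfolding S_def JK using A JK by (intro sum_exchange_copies) auto
  \<comment> \<open>The sign of \<open>a - b + c\<close> is not evident here; \<open>iff\<close>
    accepts any real multiple.\<close>
  then have "S ((A - J) \<union> K) x = (a - b + c) * (norm x)\<^sup>2" for x
    by (simp add: a b c algebra_simps)
  then show ?thesis
    unfolding iff S_def using sub \<open>K \<subseteq> I\<close> by blast
qed

theorem proposition4:
  fixes I :: "'i set"
  assumes "finite I"
  shows "(\<forall>(f :: 'i \<Rightarrow> real ^ 'n) P J K A.
            is_frame f I \<and> (\<forall>i\<in>I. f i \<noteq> 0) \<and> P = factor_poset inner f I \<and>
            copies I P J K \<and> A \<in> P \<and> J \<subseteq> A \<and> K \<inter> A = {}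
            \<longrightarrow> (A - J) \<union> K \<in> P) \<and>
         (\<forall>(f :: 'i \<Rightarrow> complex ^ 'n) P J K A.
            is_frame f I \<and> (\<forall>i\<in>I. f i \<noteq> 0) \<and> P = factor_poset cinner f I \<and>
            copies I P J K \<and> A \<in> P \<and> J \<subseteq> A \<and> K \<inter> A = {}
            \<longrightarrow> (A - J) \<union> K \<in> P)"
proof (intro conjI allI impI; elim conjE)
  fix f :: "'i \<Rightarrow> real ^ 'n" and P J K A
  assume nz: "\<forall>i\<in>I. f i \<noteq> 0" and P: "P = factor_poset inner f I" and cp: "copies I P J K"
    and A: "A \<in> P" "J \<subseteq> A" "K \<inter> A = {}"
  show "(A - J) \<union> K \<in> P"
    unfolding P
  \<comment> \<open>What depends on the field is definiteness and the vector orthogonal to a proper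
    span; the complex case below differs only there.\<close>
  proof (rule factor_poset_closure[OF assms])
    show "f i \<noteq> 0" if "i \<in> I" for i using nz that by blast
    show "x = 0" if "inner x x = 0" for x :: "real ^ 'n"
      using that by simp
  qed (use cp A P in \<open>simp_all add: real_orthogonal_to_span\<close>)
next
  fix f :: "'i \<Rightarrow> complex ^ 'n" and P J K A
  assume nz: "\<forall>i\<in>I. f i \<noteq> 0" and P: "P = factor_poset cinner f I" and cp: "copies I P J K"
    and A: "A \<in> P" "J \<subseteq> A" "K \<inter> A = {}"
  show "(A - J) \<union> K \<in> P"
    unfolding P
  proof (rule factor_poset_closure[OF assms])
    show "f i \<noteq> 0" if "i \<in> I" for i using nz that by blast
    show "x = 0" if "cinner x x = 0" for x :: "complex ^ 'n"
      using that by (simp add: cinner_self_eq_0)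
  qed (use cp A P in \<open>simp_all add: complex_orthogonal_to_span\<close>)
qed

end
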